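(* Let $G$ be an unmixed bipartite graph on the vertex set $\{x_1,\ldots,x_n\}\cup\{y_1,\ldots,y_n\}$ with $\{x_i,y_i\}\in E(G)$ for all $i$, and let $\mathcal{L}_G$ be its lattice of vertex covers. There is a correspondence between the basis elements $b(p;S)$ of the minimal multigraded free resolution $\mathbb{F}$ of $H_{\mathcal{L}_G}$ and the intervals in $\mathcal{L}_G$ which are isomorphic to a Boolean lattice.
   Context: All graphs are finite and have no isolated vertices. A graph is unmixed if all its minimal vertex covers have the same cardinality. An unmixed bipartite graph has bipartition classes of equal size and a perfect matching, so its vertices can be labelled $x_1,\dots,x_n$ and $y_1,\dots,y_n$ (the two classes) with $\{x_i,y_i\}\in E(G)$ for all $i$; every minimal vertex cover then contains exactly one of $x_i,y_i$ for each $i$. Put $\mathcal{L}_G=\{C\cap\{x_1,\dots,x_n\} : C \text{ is a minimal vertex cover of } G\}$, viewed also as a family of subsets of $[n]$ by identifying $x_i$ with $i$. It is known that $\mathcal{L}_G$ is a sublattice of the Boolean lattice of all subsets, containing $\emptyset$ and the whole set; thus $\wedge$ is intersection and $\vee$ is union. $N(p)$ denotes the set of lower neighbors of $p$ in $\mathcal{L}_G$, i.e. the elements of $\mathcal{L}_G$ covered by $p$. Intervals are the sets $[a,p]=\{c\in\mathcal{L}_G: a\le c\le p\}$ with $a\leq p$ in $\mathcal{L}_G$. $K$ is a field, $u_p=\prod_{i\in p}x_i\prod_{j\in[n]\setminus p}y_j$ for $p\in\mathcal{L}_G$, and $H_{\mathcal{L}_G}=(u_p:p\in\mathcal{L}_G)\subseteq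 K[x_1,\dots,x_n,y_1,\dots,y_n]$. The ideal $H_{\mathcal{L}_G}$ has a minimal multigraded free resolution $\mathbb{F}$ in which $\mathbb{F}_i$ has a basis of elements $b(p;S)$, one for each pair $p\in\mathcal{L}_G$, $S\subseteq N(p)$ with $|S|=i$, of multidegree $\operatorname{lcm}(u_p,u_q:q\in S)$; these are the basis elements meant in the claim. *)

theory Defs
  imports Complex_Main "HOL-Library.Poly_Mapping"
begin

section \<open>Graphs and vertex covers\<close>

text \<open>A graph on the vertex set \<open>V\<close> is given by its set of edges, the latter being two-element sets.\<close>

definition simple_graph :: "'v set \<Rightarrow> 'v set set \<Rightarrow> bool" where
  "simple_graph V E \<longleftrightarrow> finite V \<and> (\<forall>e\<in>E. e \<subseteq> V \<and> card e = 2)"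

definition no_isolated_vertices :: "'v set \<Rightarrow> 'v set set \<Rightarrow> bool" where
  "no_isolated_vertices V E \<longleftrightarrow> (\<forall>v\<in>V. \<exists>e\<in>E. v \<in> e)"

definition bipartition :: "'v set \<Rightarrow> 'v set set \<Rightarrow> 'v set \<Rightarrow> 'v set \<Rightarrow> bool" where
  "bipartition V E A B \<longleftrightarrow>
     A \<union> B = V \<and> A \<inter> B = {} \<and> (\<forall>e\<in>E. \<exists>a\<in>A. \<exists>b\<in>B. e = {a, b})"

definition vertex_cover :: "'v set \<Rightarrow> 'v set set \<Rightarrow> 'v set \<Rightarrow> bool" where
  "vertex_cover V E C \<longleftrightarrow> C \<subseteq> V \<and> (\<forall>e\<in>E. e \<inter> C \<noteq> {})"

definition minimal_vertex_cover :: "'v set \<Rightarrow> 'v set set \<Rightarrow> 'v set \<Rightarrow> bool" where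
  "minimal_vertex_cover V E C \<longleftrightarrow>
     vertex_cover V E C \<and> (\<forall>D. D \<subset> C \<longrightarrow> \<not> vertex_cover V E D)"

definition unmixed :: "'v set \<Rightarrow> 'v set set \<Rightarrow> bool" where
  "unmixed V E \<longleftrightarrow>
     (\<forall>C D. minimal_vertex_cover V E C \<longrightarrow> minimal_vertex_cover V E D \<longrightarrow> card C = card D)"

text \<open>
  The index set \<open>[n]\<close> is (the universe of) a finite type \<open>'n\<close>. The vertex \<open>x\<^sub>i\<close> is \<open>Inl i\<close>
  and the vertex \<open>y\<^sub>i\<close> is \<open>Inr i\<close>; the same symbols serve as the variables of the polynomial
  ring, which therefore has exactly the variables \<open>x\<^sub>i, y\<^sub>i\<close> for \<open>i \<in> [n]\<close>.
\<close>

type_synonym 'n vertex = "'n + 'n"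

abbreviation xv :: "'n \<Rightarrow> 'n vertex" where "xv \<equiv> Inl"
abbreviation yv :: "'n \<Rightarrow> 'n vertex" where "yv \<equiv> Inr"

text \<open>The intersections of the minimal vertex covers with the \<open>x\<close>-class, \<open>x\<^sub>i\<close> being identified with \<open>i\<close>.\<close>

definition cover_lattice :: "'n vertex set set \<Rightarrow> 'n set set" where
  "cover_lattice E = {{i. xv i \<in> C} | C. minimal_vertex_cover UNIV E C}"


section \<open>Families of sets ordered by inclusion\<close>

definition lower_neighbors :: "'a set set \<Rightarrow> 'a set \<Rightarrow> 'a set set" where
  "lower_neighbors L p = {q \<in> L. q \<subset> p \<and> \<not> (\<exists>r\<in>L. q \<subset> r \<and> r \<subset> p)}"

definition interval :: "'a set set \<Rightarrow> 'a set \<Rightarrow> 'a set \<Rightarrow> 'a set set" where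
  "interval L a p = {c \<in> L. a \<subseteq> c \<and> c \<subseteq> p}"

definition intervals :: "'a set set \<Rightarrow> 'a set set set" where
  "intervals L = {interval L a p | a p. a \<in> L \<and> p \<in> L \<and> a \<subseteq> p}"

text \<open>
  Order isomorphism with the lattice of all subsets of a \<open>k\<close>-element set; \<open>k = 0\<close> (a single
  point) is allowed.
\<close>

definition isomorphic_to_boolean_lattice :: "'a set set \<Rightarrow> bool" where
  "isomorphic_to_boolean_lattice I \<longleftrightarrow>
     (\<exists>(k::nat) f. bij_betw f I (Pow {..<k}) \<and> (\<forall>c\<in>I. \<forall>d\<in>I. c \<subseteq> d \<longleftrightarrow> f c \<subseteq> f d))"


section \<open>Polynomial rings and multigraded free resolutions\<close>

text \<open>Exponent vectors represent monomials and also serve as multidegrees.\<close>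

type_synonym 'v exponent = "'v \<Rightarrow>\<^sub>0 nat"
type_synonym ('v, 'k) polynomial = "('v \<Rightarrow>\<^sub>0 nat) \<Rightarrow>\<^sub>0 'k"

definition indet :: "'v \<Rightarrow> ('v, 'k::field) polynomial" where
  "indet v = Poly_Mapping.single (Poly_Mapping.single v 1) 1"

text \<open>The least common multiple of a nonempty finite set of monomials.\<close>

definition lcm_exponent :: "('v::finite) exponent set \<Rightarrow> 'v exponent" where
  "lcm_exponent A =
     (\<Sum>v\<in>UNIV. Poly_Mapping.single v (Max ((\<lambda>m. Poly_Mapping.lookup m v) ` A)))"

lemma lookup_lcm_exponent:
  "Poly_Mapping.lookup (lcm_exponent A) v = Max ((\<lambda>m. Poly_Mapping.lookup m v) ` A)"
  unfolding lcm_exponent_def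
  by (simp add: lookup_sum lookup_single when_def)

text \<open>
  The free module with basis \<open>B\<close> over the polynomial ring consists of the finitely supported
  functions \<open>B \<Rightarrow> R\<close>; the basis element belonging to \<open>\<beta> \<in> B\<close> is \<open>basis_element \<beta>\<close>.
\<close>

type_synonym ('b, 'v, 'k) free = "'b \<Rightarrow>\<^sub>0 (('v \<Rightarrow>\<^sub>0 nat) \<Rightarrow>\<^sub>0 'k)"

definition free_scale ::
    "('v, 'k::field) polynomial \<Rightarrow> ('b, 'v, 'k) free \<Rightarrow> ('b, 'v, 'k) free" where
  "free_scale r f = Poly_Mapping.map (\<lambda>s. r * s) f"

definition free_module :: "'b set \<Rightarrow> ('b, 'v, 'k::field) free set" where
  "free_module B = {f. Poly_Mapping.keys f \<subseteq> B}"

definition basis_element :: "'b \<Rightarrow> ('b, 'v, 'k::field) free" where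
  "basis_element \<beta> = Poly_Mapping.single \<beta> 1"

lemma lookup_free_scale:
  "Poly_Mapping.lookup (free_scale r f) \<beta> = r * Poly_Mapping.lookup f \<beta>"
  by (simp add: free_scale_def map.rep_eq when_def)

lemma module_free_scale: "module free_scale"
  by unfold_locales
    (auto intro!: poly_mapping_eqI simp: lookup_free_scale lookup_add algebra_simps)

lemma module_polynomial:
  "module ((*) :: ('v, 'k::field) polynomial \<Rightarrow> ('v, 'k) polynomial \<Rightarrow> ('v, 'k) polynomial)"
  by unfold_locales (auto simp: algebra_simps)

definition ideal_of :: "('v, 'k::field) polynomial set \<Rightarrow> ('v, 'k) polynomial set" where
  "ideal_of A = module.span (*) A"

definition variables_ideal :: "('v, 'k::field) polynomial set" where
  "variables_ideal = ideal_of (range indet)"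

text \<open>
  \<open>f\<close> is homogeneous of multidegree \<open>a\<close>, where the basis element \<open>\<beta>\<close> is given the
  multidegree \<open>deg \<beta>\<close>.
\<close>

definition multihomogeneous ::
    "('b \<Rightarrow> 'v exponent) \<Rightarrow> 'v exponent \<Rightarrow> ('b, 'v, 'k::field) free \<Rightarrow> bool" where
  "multihomogeneous deg a f \<longleftrightarrow>
     (\<forall>\<beta>\<in>Poly_Mapping.keys f. \<forall>m\<in>Poly_Mapping.keys (Poly_Mapping.lookup f \<beta>). m + deg \<beta> = a)"

text \<open>
  The complex is \<open>\<dots> \<rightarrow> F\<^sub>2 \<rightarrow> F\<^sub>1 \<rightarrow> F\<^sub>0 \<rightarrow> I \<rightarrow> 0\<close> with \<open>F\<^sub>i = free_module (B i)\<close>, differentials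
  \<open>d i\<close> from \<open>F\<^sub>i\<^sub>+\<^sub>1\<close> to \<open>F\<^sub>i\<close> and augmentation \<open>\<epsilon>\<close> from \<open>F\<^sub>0\<close> onto \<open>I\<close>. The maps are taken to be
  linear on all finitely supported functions, not just on those supported in \<open>B i\<close>; this is no
  restriction, since a linear map on \<open>F\<^sub>i\<close> extends by zero on the remaining basis elements.
  Minimality means \<open>d i (F\<^sub>i\<^sub>+\<^sub>1) \<subseteq> \<mm> F\<^sub>i\<close>, where \<open>\<mm>\<close> is the ideal generated by the variables.
\<close>

definition minimal_multigraded_free_resolution ::
    "('v, 'k::field) polynomial set \<Rightarrow> (nat \<Rightarrow> 'b set) \<Rightarrow> ('b \<Rightarrow> 'v exponent) \<Rightarrow>
     (nat \<Rightarrow> ('b, 'v, 'k) free \<Rightarrow> ('b, 'v, 'k) free) \<Rightarrow>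
     (('b, 'v, 'k) free \<Rightarrow> ('v, 'k) polynomial) \<Rightarrow> bool" where
  "minimal_multigraded_free_resolution I B deg d \<epsilon> \<longleftrightarrow>
     (\<forall>i. module_hom free_scale free_scale (d i)) \<and> module_hom free_scale (*) \<epsilon> \<and>
     \<comment> \<open>exactness\<close>
     \<epsilon> ` free_module (B 0) = I \<and>
     d 0 ` free_module (B 1) = {f \<in> free_module (B 0). \<epsilon> f = 0} \<and>
     (\<forall>i. d (Suc i) ` free_module (B (Suc (Suc i))) = {f \<in> free_module (B (Suc i)). d i f = 0}) \<and>
     \<comment> \<open>the maps preserve multidegrees\<close>
     (\<forall>a. \<forall>f\<in>free_module (B 0). multihomogeneous deg a f \<longrightarrow> Poly_Mapping.keys (\<epsilon> f) \<subseteq> {a}) \<and>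
     (\<forall>i a. \<forall>f\<in>free_module (B (Suc i)). multihomogeneous deg a f \<longrightarrow> multihomogeneous deg a (d i f)) \<and>
     \<comment> \<open>minimality\<close>
     (\<forall>i. \<forall>f\<in>free_module (B (Suc i)). \<forall>\<beta>. Poly_Mapping.lookup (d i f) \<beta> \<in> variables_ideal)"


section \<open>The ideal of a family of subsets of the index set\<close>

definition u_monomial :: "('n::finite) set \<Rightarrow> ('n vertex, 'k::field) polynomial" where
  "u_monomial p = (\<Prod>i\<in>p. indet (xv i)) * (\<Prod>j\<in>UNIV - p. indet (yv j))"

definition u_exponent :: "('n::finite) set \<Rightarrow> 'n vertex exponent" where
  "u_exponent p =
     (\<Sum>i\<in>p. Poly_Mapping.single (xv i) 1) + (\<Sum>j\<in>UNIV - p. Poly_Mapping.single (yv j) 1)"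

lemma prod_indet:
  "finite A \<Longrightarrow> (\<Prod>i\<in>A. indet (g i)) =
     (Poly_Mapping.single (\<Sum>i\<in>A. Poly_Mapping.single (g i) 1) 1 :: ('v, 'k::field) polynomial)"
  by (induction A rule: finite_induct) (simp_all add: indet_def mult_single)

lemma u_monomial_eq_single: "u_monomial p = Poly_Mapping.single (u_exponent p) 1"
  unfolding u_monomial_def u_exponent_def by (simp add: prod_indet mult_single)

definition H_ideal :: "('n::finite) set set \<Rightarrow> ('n vertex, 'k::field) polynomial set" where
  "H_ideal L = ideal_of (u_monomial ` L)"

text \<open>
  The pair \<open>(p, S)\<close> indexes the basis element \<open>b(p;S)\<close>, which lives in homological degree
  \<open>card S\<close> and has multidegree \<open>lcm(u\<^sub>p, u\<^sub>q : q \<in> S)\<close>.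
\<close>

type_synonym 'n basis_index = "'n set \<times> 'n set set"

definition basis_indices :: "'n set set \<Rightarrow> nat \<Rightarrow> 'n basis_index set" where
  "basis_indices L i = {(p, S). p \<in> L \<and> S \<subseteq> lower_neighbors L p \<and> card S = i}"

definition basis_multidegree :: "('n::finite) basis_index \<Rightarrow> 'n vertex exponent" where
  "basis_multidegree = (\<lambda>(p, S). lcm_exponent (u_exponent ` insert p S))"

abbreviation basis_b :: "'n set \<Rightarrow> 'n set set \<Rightarrow> ('n basis_index, 'n vertex, 'k::field) free" where
  "basis_b p S \<equiv> basis_element (p, S)"

end

theory Submission
  imports Defs "HOL-Library.Cardinality"
begin

text \<open>
  Comparing with the cover consisting of all \<open>x\<^sub>i\<close>, unmixedness forces a minimal vertex cover to
  contain exactly one of \<open>x\<^sub>i, y\<^sub>i\<close>, so \<open>\<L>\<^sub>G\<close> is described by implications \<open>j \<in> p \<longrightarrow> i \<in> p\<close> and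
  is closed under union and intersection. In such a family two distinct lower neighbors of \<open>p\<close> have
  union \<open>p\<close>; hence the sets \<open>p - q\<close> with \<open>q\<close> a lower neighbor are pairwise disjoint, each of
  them is either contained in or disjoint from any element below \<open>p\<close>, and an element of the
  interval from \<open>\<Inter>(insert p S)\<close> to \<open>p\<close> amounts to a subset of \<open>S\<close>. Conversely, in a Boolean interval
  the bottom is the meet of the coatoms, which are lower neighbors of the top.
\<close>

section \<open>Lower neighbors and Boolean intervals in a finite lattice of sets\<close>

lemma lower_neighborsD:
  assumes "q \<in> lower_neighbors L p"
  shows "q \<in> L" "q \<subset> p" "\<And>r. r \<in> L \<Longrightarrow> q \<subseteq> r \<Longrightarrow> r \<subseteq> p \<Longrightarrow> r = q \<or> r = p"
  using assms unfolding lower_neighbors_def by blast+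

lemma interval_eqD:
  assumes "interval L a p = interval L b q"
    and "a \<in> L" "p \<in> L" "a \<subseteq> p" "b \<in> L" "q \<in> L" "b \<subseteq> q"
  shows "a = b" "p = q"
proof -
  have "a \<in> interval L b q" "p \<in> interval L b q" "b \<in> interval L a p" "q \<in> interval L a p"
    using assms unfolding interval_def by blast+
  then show "a = b" "p = q" unfolding interval_def by blast+
qed

locale set_lattice =
  fixes L :: "'a set set"
  assumes finite: "finite L"
    and Int_closed: "p \<in> L \<Longrightarrow> q \<in> L \<Longrightarrow> p \<inter> q \<in> L"
    and Un_closed: "p \<in> L \<Longrightarrow> q \<in> L \<Longrightarrow> p \<union> q \<in> L"
begin

text \<open>Inserting \<open>p\<close> settles the case of empty \<open>S\<close>: the meet is then
  \<open>p\<close> and not the universal set.\<close>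

lemma Inter_closed:
  assumes "p \<in> L" "S \<subseteq> L"
  shows "\<Inter> (insert p S) \<in> L"
proof -
  have "finite S" using assms(2) finite finite_subset by blast
  then show ?thesis using assms(2)
  proof (induction S rule: finite_induct)
    case empty
    then show ?case using assms(1) by simp
  next
    case (insert q S)
    then have "q \<inter> \<Inter> (insert p S) \<in> L" by (intro Int_closed) auto
    moreover have "q \<inter> \<Inter> (insert p S) = \<Inter> (insert p (insert q S))" by blast
    ultimately show ?case by simp
  qed
qed

text \<open>\<open>c \<union> q\<close> lies in \<open>L\<close> between \<open>q\<close> and
  \<open>p\<close>, where there is no room for a third element.\<close>

lemma lower_neighbor_Un:
  assumes "q \<in> lower_neighbors L p" "c \<in> L" "c \<subseteq> p"
  shows "c \<subseteq> q \<or> c \<union> q = p"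
proof -
  have "c \<union> q = q \<or> c \<union> q = p"
    using lower_neighborsD[OF assms(1)] assms(2,3) Un_closed by (metis Un_upper2 le_sup_iff psubset_imp_subset)
  then show ?thesis by blast
qed

lemma distinct_lower_neighbors_Un:
  assumes "q \<in> lower_neighbors L p" "r \<in> lower_neighbors L p" "q \<noteq> r"
  shows "q \<union> r = p"
proof -
  have "\<not> r \<subseteq> q"
    using lower_neighborsD[OF assms(1)] lower_neighborsD(2)[OF assms(1)]
      lower_neighborsD[OF assms(2)] assms(3) by blast
  then show ?thesis
    using lower_neighbor_Un[OF assms(1), of r] lower_neighborsD(1,2)[OF assms(2)] by blast
qed

text \<open>A point of \<open>p - q\<close> lies in every lower neighbor other than
  \<open>q\<close>, so it survives in the meet unless \<open>q\<close> itself is in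
  \<open>S\<close>. Hence \<open>S\<close> can be read off from its meet.\<close>

lemma lower_neighbors_Inter_subset_iff:
  assumes "S \<subseteq> lower_neighbors L p" "q \<in> lower_neighbors L p"
  shows "\<Inter> (insert p S) \<subseteq> q \<longleftrightarrow> q \<in> S"
proof
  assume sub: "\<Inter> (insert p S) \<subseteq> q"
  show "q \<in> S"
  proof (rule ccontr)
    assume "q \<notin> S"
    obtain x where x: "x \<in> p" "x \<notin> q" using lower_neighborsD(2)[OF assms(2)] by blast
    have "x \<in> r" if "r \<in> S" for r
      using distinct_lower_neighbors_Un[OF assms(2), of r] assms(1) that \<open>q \<notin> S\<close> x by blast
    with x sub show False by blast
  qed
qed blast

text \<open>The interval determines both endpoints, and \<open>S\<close> is recovered as the set of
  lower neighbors of \<open>p\<close> above the bottom.\<close>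

lemma inj_on_lower_neighbor_interval:
  "inj_on (\<lambda>(p, S). interval L (\<Inter> (insert p S)) p) {(p, S). p \<in> L \<and> S \<subseteq> lower_neighbors L p}"
proof (rule inj_onI, clarify)
  fix p S q T
  assume p: "p \<in> L" and S: "S \<subseteq> lower_neighbors L p" and q: "q \<in> L" and T: "T \<subseteq> lower_neighbors L q"
    and eq: "interval L (\<Inter> (insert p S)) p = interval L (\<Inter> (insert q T)) q"
  have "S \<subseteq> L" "T \<subseteq> L" using S T lower_neighborsD(1) by blast+
  then have "\<Inter> (insert p S) \<in> L" "\<Inter> (insert q T) \<in> L" using Inter_closed p q by blast+
  moreover have "\<Inter> (insert p S) \<subseteq> p" "\<Inter> (insert q T) \<subseteq> q" by auto
  ultimately have "\<Inter> (insert p S) = \<Inter> (insert q T)" "p = q"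
    using interval_eqD[OF eq] p q by blast+
  moreover have "S = {r \<in> lower_neighbors L p. \<Inter> (insert p S) \<subseteq> r}"
    using lower_neighbors_Inter_subset_iff[OF S] S by blast
  moreover have "T = {r \<in> lower_neighbors L q. \<Inter> (insert q T) \<subseteq> r}"
    using lower_neighbors_Inter_subset_iff[OF T] T by blast
  ultimately show "p = q \<and> S = T" by simp
qed

text \<open>The isomorphism records which members of \<open>S\<close> fail to contain
  \<open>c\<close>: none for the bottom, all of \<open>S\<close> for \<open>p\<close>.\<close>

lemma lower_neighbor_interval_boolean:
  assumes p: "p \<in> L" and S: "S \<subseteq> lower_neighbors L p"
  shows "isomorphic_to_boolean_lattice (interval L (\<Inter> (insert p S)) p)"
proof -
  let ?I = "interval L (\<Inter> (insert p S)) p"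
  let ?f = "\<lambda>c. {q \<in> S. \<not> c \<subseteq> q}"
  have SL: "S \<subseteq> L" using S lower_neighborsD(1) by blast
  have order: "c \<subseteq> e \<longleftrightarrow> ?f c \<subseteq> ?f e" if c: "c \<in> ?I" and e: "e \<in> ?I" for c e
  proof
    assume le: "?f c \<subseteq> ?f e"
    show "c \<subseteq> e"
    proof
      fix x assume x: "x \<in> c"
      show "x \<in> e"
      proof (cases "x \<in> \<Inter> (insert p S)")
        case True
        then show ?thesis using e unfolding interval_def by blast
      next
        case False
        \<comment> \<open>The \<open>q\<close> that misses \<open>x\<close> lies in
          \<open>?f c\<close>, hence in \<open>?f e\<close>; so \<open>e\<close> and
          \<open>q\<close> together fill \<open>p\<close>, and \<open>x\<close> must come from
          \<open>e\<close>.\<close>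
        with x c obtain q where q: "q \<in> S" "x \<notin> q" unfolding interval_def by blast
        then have "\<not> e \<subseteq> q" using le x by blast
        then have "e \<union> q = p" using lower_neighbor_Un[of q p e] S q e unfolding interval_def by blast
        then show ?thesis using q x c unfolding interval_def by blast
      qed
    qed
  qed blast
  have "bij_betw ?f ?I (Pow S)"
    unfolding bij_betw_def
  proof
    show "inj_on ?f ?I"
    proof (rule inj_onI)
      fix c e assume "c \<in> ?I" "e \<in> ?I" "?f c = ?f e"
      then show "c = e" using order[of c e] order[of e c] by simp
    qed
    show "?f ` ?I = Pow S"
    proof
      show "Pow S \<subseteq> ?f ` ?I"
      proof
        fix T assume "T \<in> Pow S"
        then have T: "T \<subseteq> S" by simp
        \<comment> \<open>Only the members of \<open>S - T\<close> are intersected, so these are the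
          members of \<open>S\<close> that contain the result.\<close>
        let ?c = "\<Inter> (insert p (S - T))"
        have "?c \<in> L" by (rule Inter_closed) (use p SL in auto)
        then have "?c \<in> ?I" unfolding interval_def by blast
        moreover have "?c \<subseteq> q \<longleftrightarrow> q \<notin> T" if "q \<in> S" for q
          using lower_neighbors_Inter_subset_iff[of "S - T" p q] S that by blast
        then have "T = ?f ?c" using T by blast
        ultimately show "T \<in> ?f ` ?I" by (rule rev_image_eqI)
      qed
    qed blast
  qed
  moreover have "finite S" using SL finite finite_subset by blast
  then obtain g where g: "bij_betw g S {..<card S}"
    using ex_bij_betw_finite_nat atLeast0LessThan by metis
  ultimately have "bij_betw (image g \<circ> ?f) ?I (Pow {..<card S})"
    by (blast intro: bij_betw_trans bij_betw_Pow)
  moreover have "c \<subseteq> e \<longleftrightarrow> (image g \<circ> ?f) c \<subseteq> (image g \<circ> ?f) e" if "c \<in> ?I" "e \<in> ?I" for c e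
    using order[OF that] inj_on_image_mem_iff[OF bij_betw_imp_inj_on[OF g], of _ "?f e"]
    unfolding o_def image_subset_iff by blast
  ultimately show ?thesis unfolding isomorphic_to_boolean_lattice_def by blast
qed

text \<open>If the image of the meet \<open>?b\<close> contained some \<open>j\<close>, the coatom
  omitting \<open>j\<close> would come from a lower neighbor of \<open>p\<close> above
  \<open>a\<close>. This contains \<open>?b\<close> by construction, a contradiction.\<close>

lemma boolean_interval_bottom:
  assumes a: "a \<in> L" and p: "p \<in> L" and "a \<subseteq> p"
    and "isomorphic_to_boolean_lattice (interval L a p)"
  shows "\<Inter> (insert p {q \<in> lower_neighbors L p. a \<subseteq> q}) = a"
proof -
  let ?I = "interval L a p" and ?b = "\<Inter> (insert p {q \<in> lower_neighbors L p. a \<subseteq> q})"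
  obtain k :: nat and f where f: "bij_betw f ?I (Pow {..<k})"
    and order: "\<And>c e. c \<in> ?I \<Longrightarrow> e \<in> ?I \<Longrightarrow> c \<subseteq> e \<longleftrightarrow> f c \<subseteq> f e"
    using assms(4) unfolding isomorphic_to_boolean_lattice_def by auto
  have aI: "a \<in> ?I" and pI: "p \<in> ?I" using assms unfolding interval_def by auto
  have "?b \<in> L" by (rule Inter_closed) (use p lower_neighborsD(1) in auto)
  then have bI: "?b \<in> ?I" using \<open>a \<subseteq> p\<close> unfolding interval_def by blast
  have f_range: "f c \<subseteq> {..<k}" if "c \<in> ?I" for c
    using f that bij_betwE by blast
  have "j \<notin> f ?b" for j
  proof
    assume j: "j \<in> f ?b"
    have "{..<k} - {j} \<in> f ` ?I" using f by (auto simp: bij_betw_def)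
    then obtain q where q: "q \<in> ?I" "f q = {..<k} - {j}" by auto
    have jk: "j < k" using j f_range[OF bI] by blast
    \<comment> \<open>As the top of the interval, \<open>p\<close> has the full set as image,
      whereas \<open>f q\<close> lacks \<open>j\<close>.\<close>
    have "{..<k} \<in> f ` ?I" using f by (auto simp: bij_betw_def)
    then obtain c where c: "c \<in> ?I" "f c = {..<k}" by auto
    then have "{..<k} \<subseteq> f p" using order[OF c(1) pI] unfolding interval_def by simp
    then have "q \<noteq> p" using q jk by auto
    \<comment> \<open>Such an \<open>r\<close> would belong to the interval, but no set lies
      strictly between \<open>{..<k} - {j}\<close> and \<open>{..<k}\<close>.\<close>
    moreover have "\<not> (q \<subset> r \<and> r \<subset> p)" if "r \<in> L" for r
    proof
      assume r: "q \<subset> r \<and> r \<subset> p"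
      then have rI: "r \<in> ?I" using that q(1) unfolding interval_def by blast
      have "\<not> f r \<subseteq> f q" "\<not> f p \<subseteq> f r" "f q \<subseteq> f r"
        using order[OF q(1) rI] order[OF rI q(1)] order[OF pI rI] r by blast+
      then show False using q(2) f_range[OF rI] f_range[OF pI] by blast
    qed
    ultimately have "q \<in> lower_neighbors L p" "a \<subseteq> q"
      using q(1) unfolding lower_neighbors_def interval_def by blast+
    then have "?b \<subseteq> q" by blast
    then have "f ?b \<subseteq> f q" using order[OF bI q(1)] by blast
    then show False using j q(2) by blast
  qed
  \<comment> \<open>\<open>f ?b\<close> is empty, so the value of \<open>f a\<close> need not be
    computed.\<close>
  then have "f ?b \<subseteq> f a" by blast
  then have "?b \<subseteq> a" using order[OF bI aI] by blast
  then show ?thesis using bI unfolding interval_def by blast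
qed

theorem bij_betw_lower_neighbor_intervals:
  "bij_betw (\<lambda>(p, S). interval L (\<Inter> (insert p S)) p)
     {(p, S). p \<in> L \<and> S \<subseteq> lower_neighbors L p}
     {I \<in> intervals L. isomorphic_to_boolean_lattice I}"
  (is "bij_betw ?F ?A ?B")
  unfolding bij_betw_def
proof
  show "inj_on ?F ?A" by (rule inj_on_lower_neighbor_interval)
  show "?F ` ?A = ?B"
  proof
    show "?F ` ?A \<subseteq> ?B"
    proof clarify
      fix p S assume p: "p \<in> L" and S: "S \<subseteq> lower_neighbors L p"
      have "\<Inter> (insert p S) \<in> L"
        by (rule Inter_closed) (use p S lower_neighborsD(1) in blast)+
      then have "interval L (\<Inter> (insert p S)) p \<in> intervals L"
        using p unfolding intervals_def by blast
      then show "interval L (\<Inter> (insert p S)) p \<in> intervals L \<and>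
          isomorphic_to_boolean_lattice (interval L (\<Inter> (insert p S)) p)"
        using lower_neighbor_interval_boolean[OF p S] by blast
    qed
    show "?B \<subseteq> ?F ` ?A"
    proof
      fix I assume "I \<in> ?B"
      then obtain a p where ap: "a \<in> L" "p \<in> L" "a \<subseteq> p" "I = interval L a p"
        "isomorphic_to_boolean_lattice (interval L a p)"
        unfolding intervals_def by blast
      \<comment> \<open>The only possible choice, since \<open>S\<close> consists of the lower
        neighbors above the bottom.\<close>
      let ?S = "{q \<in> lower_neighbors L p. a \<subseteq> q}"
      have "I = ?F (p, ?S)"
        using boolean_interval_bottom[of a p] ap by simp
      then show "I \<in> ?F ` ?A" using ap(2) by blast
    qed
  qed
qed

end

section \<open>Vertex covers of an unmixed bipartite graph with a perfect matching\<close>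

lemma card_split_x_y:
  fixes C :: "('n::finite) vertex set"
  shows "card C = card {i. xv i \<in> C} + card {i. yv i \<in> C}"
proof -
  have "C = {i. xv i \<in> C} <+> {i. yv i \<in> C}"
    by (auto simp: Plus_def image_iff) (metis sum.exhaust)
  then show ?thesis by (metis card_Plus finite)
qed

text \<open>Each matching edge is covered, so every index occurs on the x or the y side; the excess
  of \<open>card C\<close> over \<open>CARD('n)\<close> counts the indices occurring on
  both.\<close>

lemma vertex_cover_card_ge:
  fixes C :: "('n::finite) vertex set"
  assumes "\<And>i. {xv i, yv i} \<in> E" "vertex_cover UNIV E C"
  shows "CARD('n) \<le> card C"
    and "card C = CARD('n) \<Longrightarrow> yv i \<in> C \<longleftrightarrow> xv i \<notin> C"
proof -
  let ?X = "{i. xv i \<in> C}" and ?Y = "{i. yv i \<in> C}"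
  have "{xv i, yv i} \<inter> C \<noteq> {}" for i
    using assms unfolding vertex_cover_def by blast
  then have un: "?X \<union> ?Y = UNIV" by blast
  have sum: "card C = CARD('n) + card (?X \<inter> ?Y)"
    using card_split_x_y[of C] card_Un_Int[of ?X ?Y] un by simp
  then show "CARD('n) \<le> card C" by simp
  show "yv i \<in> C \<longleftrightarrow> xv i \<notin> C" if "card C = CARD('n)"
  proof -
    have "?X \<inter> ?Y = {}" using sum that by simp
    then show ?thesis using un by blast
  qed
qed

text \<open>A cover attaining the lower bound has no proper subcover. The x-class is one, and
  unmixedness passes its size on to all minimal covers.\<close>

lemma minimal_vertex_cover_iff_card:
  fixes C :: "('n::finite) vertex set"
  assumes "bipartition UNIV E (range xv) (range yv)" "unmixed UNIV E"
    and matching: "\<And>i. {xv i, yv i} \<in> E"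
  shows "minimal_vertex_cover UNIV E C \<longleftrightarrow> vertex_cover UNIV E C \<and> card C = CARD('n)"
proof -
  have minimal: "minimal_vertex_cover UNIV E D" if "vertex_cover UNIV E D" "card D = CARD('n)" for D
    using that vertex_cover_card_ge(1)[OF matching] unfolding minimal_vertex_cover_def
    by (metis finite psubset_card_mono leD)
  have "vertex_cover UNIV E (range xv)"
    using assms(1) unfolding vertex_cover_def bipartition_def by fast
  moreover have "card (range (xv :: 'n \<Rightarrow> 'n vertex)) = CARD('n)"
    by (simp add: card_image)
  ultimately show ?thesis
    using minimal assms(2) unfolding unmixed_def minimal_vertex_cover_def by metis
qed

text \<open>Since \<open>yv j\<close> is in \<open>C\<close> exactly when \<open>j\<close> is not in
  \<open>p\<close>, covering the edge \<open>{xv i, yv j}\<close> becomes an implication.\<close>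

lemma cover_lattice_eq:
  fixes E :: "('n::finite) vertex set set"
  assumes "bipartition UNIV E (range xv) (range yv)" "unmixed UNIV E"
    and matching: "\<And>i. {xv i, yv i} \<in> E"
  shows "cover_lattice E = {p. \<forall>i j. {xv i, yv j} \<in> E \<longrightarrow> j \<in> p \<longrightarrow> i \<in> p}" (is "_ = ?R")
proof (intro subset_antisym subsetI)
  fix p assume "p \<in> cover_lattice E"
  then obtain C where C: "vertex_cover UNIV E C" "card C = CARD('n)" "p = {i. xv i \<in> C}"
    unfolding cover_lattice_def minimal_vertex_cover_iff_card[OF assms] by blast
  have "xv i \<in> C \<or> yv j \<in> C" if "{xv i, yv j} \<in> E" for i j
    using C(1) that unfolding vertex_cover_def by fastforce
  then show "p \<in> ?R"
    using vertex_cover_card_ge(2)[OF matching C(1,2)] C(3) by blast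
next
  fix p assume p: "p \<in> ?R"
  \<comment> \<open>A minimal cover with x-part \<open>p\<close> must have the complement of
    \<open>p\<close> as its y-part.\<close>
  let ?C = "xv ` p \<union> yv ` (- p)"
  have "e \<inter> ?C \<noteq> {}" if e: "e \<in> E" for e
  proof -
    obtain i j where ij: "e = {xv i, yv j}"
      using assms(1) e unfolding bipartition_def by fast
    then have "i \<in> p \<or> j \<notin> p" using p e by blast
    then show ?thesis using ij by blast
  qed
  then have "vertex_cover UNIV E ?C" unfolding vertex_cover_def by blast
  moreover have "{i. xv i \<in> ?C} = p" "{i. yv i \<in> ?C} = - p" by auto
  then have "card ?C = CARD('n)" "p = {i. xv i \<in> ?C}"
    using card_split_x_y[of ?C] card_Un_disjoint[of p "- p"] by (auto simp: Compl_partition)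
  ultimately show "p \<in> cover_lattice E"
    unfolding cover_lattice_def minimal_vertex_cover_iff_card[OF assms] by blast
qed

section \<open>From index pairs to basis elements of the resolution\<close>

lemma inj_basis_element: "inj (basis_element :: 'b \<Rightarrow> ('b, 'v, 'k::field) free)"
  by (rule injI) (metis basis_element_def lookup_single_eq lookup_single_not_eq zero_neq_one)

theorem proposition1p4:
  fixes E :: "('n::finite) vertex set set"
    and d :: "nat \<Rightarrow> ('n basis_index, 'n vertex, 'k::field) free \<Rightarrow> ('n basis_index, 'n vertex, 'k) free"
    and \<epsilon> :: "('n basis_index, 'n vertex, 'k) free \<Rightarrow> ('n vertex, 'k) polynomial"
  assumes "simple_graph UNIV E"
    and "no_isolated_vertices UNIV E"
    and "bipartition UNIV E (range xv) (range yv)"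
    and "unmixed UNIV E"
    and "\<And>i. {xv i, yv i} \<in> E"
    and "minimal_multigraded_free_resolution (H_ideal (cover_lattice E))
           (basis_indices (cover_lattice E)) basis_multidegree d \<epsilon>"
  shows "\<exists>\<Phi>. bij_betw \<Phi>
               {basis_b p S :: ('n basis_index, 'n vertex, 'k) free | p S.
                  p \<in> cover_lattice E \<and> S \<subseteq> lower_neighbors (cover_lattice E) p}
               {I \<in> intervals (cover_lattice E). isomorphic_to_boolean_lattice I} \<and>
             (\<forall>p\<in>cover_lattice E. \<forall>S\<subseteq>lower_neighbors (cover_lattice E) p.
                \<Phi> (basis_b p S) = interval (cover_lattice E) (\<Inter> (insert p S)) p)"
proof -
  let ?L = "cover_lattice E"
  let ?F = "\<lambda>(p, S). interval ?L (\<Inter> (insert p S)) p"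
  let ?A = "{(p, S). p \<in> ?L \<and> S \<subseteq> lower_neighbors ?L p}"
  let ?b = "basis_element :: 'n basis_index \<Rightarrow> ('n basis_index, 'n vertex, 'k) free"
  \<comment> \<open>Implications with a single premise and a single conclusion survive unions and
    intersections.\<close>
  interpret set_lattice ?L
    by unfold_locales (auto simp: cover_lattice_eq[OF assms(3-5)])
  \<comment> \<open>\<open>inv ?b\<close> reads the pair \<open>(p, S)\<close> off a basis element,
    so composing with \<open>?F\<close> gives a map on the basis elements themselves.\<close>
  have "bij_betw (inv ?b) (?b ` ?A) ?A"
    by (rule bij_betw_inv_into_subset[OF inj_on_imp_bij_betw[OF inj_basis_element] subset_UNIV refl])
  then have "bij_betw (?F \<circ> inv ?b) (?b ` ?A) {I \<in> intervals ?L. isomorphic_to_boolean_lattice I}"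
    by (rule bij_betw_trans) (rule bij_betw_lower_neighbor_intervals)
  moreover have "?b ` ?A = {?b (p, S) | p S. p \<in> ?L \<and> S \<subseteq> lower_neighbors ?L p}"
    by blast
  moreover have "(?F \<circ> inv ?b) (?b (p, S)) = interval ?L (\<Inter> (insert p S)) p" for p S
    by (simp add: inv_f_f[OF inj_basis_element])
  ultimately show ?thesis
    by (intro exI[of _ "?F \<circ> inv ?b"]) simp
qed

end
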